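(* Let $\Omega\subset\mathbb{R}^d$ be a domain of finite Lebesgue measure, let $P\subset\mathbb{R}^n$ be a convex polytope with non-empty interior, and let $R$ be the polytopal Legendre function with $\operatorname{dom}(R)=P$ defined in the context. Let $\alpha>0$ and let $\bm{v}\in\mathring{\mathcal{K}}$ with $\nabla R(\bm{v})\in L^\infty(\Omega;\mathbb{R}^n)$. Suppose that $F:L^\infty(\Omega;\mathbb{R}^n)\to\mathbb{R}$ satisfies the differentiability assumption stated in the context (in particular $\nabla F(\bm{v})\in L^\infty(\Omega;\mathbb{R}^n)$ exists). Then $$\min_{\bm{\eta}\in L^1(\Omega;\mathbb{R}^n)}\Big\{J(\bm{\eta}):=\int_\Omega \alpha\nabla F(\bm{v})\cdot\bm{\eta}+\mathcal{D}_R(\bm{\eta},\bm{v})\,dx\Big\}$$ is attained at a unique point $\bm{\eta}^\star\in\mathcal{K}$. Furthermore, $\bm{\eta}^\star$ is uniformly bounded away from $\partial P$, so that $$\bm{\eta}^\star\in\mathring{\mathcal{K}}\quad\text{and}\quad\nabla R(\bm{\eta}^\star)\in L^\infty(\Omega;\mathbb{R}^n).$$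
   Context: Polytopal Legendre function: let $\bm{v}_1,\dots,\bm{v}_q\in\mathbb{R}^n$ be the vertices of $P$ and $V\in\mathbb{R}^{n\times q}$ the matrix with columns $\bm{v}_i$. Then $R:\mathbb{R}^n\to\mathbb{R}\cup\{+\infty\}$ is $$R(\bm{x})=\inf\Big\{\sum_{i=1}^q\lambda_i\ln\lambda_i\;\Big|\;\bm{\lambda}\in\mathbb{R}^q,\ \lambda_i\ge0,\ \sum_{i=1}^q\lambda_i=1,\ V\bm{\lambda}=\bm{x}\Big\},$$ with $0\ln0=0$ and $\inf\emptyset=+\infty$. It is differentiable on $\operatorname{int}(P)$. Its Bregman divergence is $\mathcal{D}_R(\bm{p},\bm{q})=R(\bm{p})-R(\bm{q})-\nabla R(\bm{q})\cdot(\bm{p}-\bm{q})\in[0,+\infty]$ for $\bm{p}\in\mathbb{R}^n$, $\bm{q}\in\operatorname{int}(P)$. Functions of vectors are applied pointwise to functions on $\Omega$: $\nabla R(\bm{v})(x)=\nabla R(\bm{v}(x))$, $\mathcal{D}_R(\bm{\eta},\bm{v})(x)=\mathcal{D}_R(\bm{\eta}(x),\bm{v}(x))$; $J$ takes values in $\mathbb{R}\cup\{+\infty\}$. Constraint sets: $\mathcal{K}=\{\bm{\eta}\in L^\infty(\Omega;\mathbb{R}^n):\bm{\eta}(x)\in P\text{ for a.e. }x\in\Omega\}$; $\mathring{\mathcal{K}}=\{\bm{\eta}\in\mathcal{K}:\operatorname{ess\,inf}_{x\in\Omega}\operatorname{dist}(\bm{\eta}(x),\partial P)>0\}$, where $\operatorname{dist}$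 is Euclidean distance; for a fixed matrix $W\in\mathbb{R}^{r\times n}$ and vector $\bm{b}\in\mathbb{R}^r$, $\mathcal{M}=\{\bm{\eta}\in L^\infty(\Omega;\mathbb{R}^n):\int_\Omega W\bm{\eta}\,dx\le\bm{b}\text{ componentwise}\}$; $\mathcal{A}=\mathcal{K}\cap\mathcal{M}$. Differentiability assumption: $F$ is continuously Fréchet differentiable on $\mathcal{A}$ and is Fréchet differentiable at $\bm{v}$, and at each such point $\bm{\eta}$ (in $\mathcal{A}$ or equal to $\bm{v}$) its derivative $F'(\bm{\eta})\in(L^\infty(\Omega;\mathbb{R}^n))'$ has a representative $\nabla F(\bm{\eta})\in L^\infty(\Omega;\mathbb{R}^n)$ characterized by $\int_\Omega\nabla F(\bm{\eta})\cdot\bm{q}\,dx=\langle F'(\bm{\eta}),\bm{q}\rangle$ for all $\bm{q}\in L^\infty(\Omega;\mathbb{R}^n)$. *)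

theory Defs
  imports "HOL-Analysis.Analysis" "HOL-Probability.Essential_Supremum"
begin

text \<open>
  Elements of \<open>L\<^sup>p(\<Omega>; \<real>\<^sup>n)\<close> are represented by functions that are measurable with respect to
  the Lebesgue measure on \<open>\<Omega>\<close> (\<^term>\<open>lebesgue_on \<Omega>\<close>); equality of classes is almost-everywhere
  equality of representatives, and a function defined on classes is one that respects it.
\<close>

section \<open>Lebesgue spaces of vector-valued functions\<close>

definition Lone :: "'a measure \<Rightarrow> ('a \<Rightarrow> 'b::euclidean_space) set" where
  "Lone M = {u. integrable M u}"

definition Linf_ereal_norm :: "'a measure \<Rightarrow> ('a \<Rightarrow> 'b::euclidean_space) \<Rightarrow> ereal" where
  "Linf_ereal_norm M u = esssup M (\<lambda>x. ereal (norm (u x)))"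

definition Linf :: "'a measure \<Rightarrow> ('a \<Rightarrow> 'b::euclidean_space) set" where
  "Linf M = {u \<in> borel_measurable M. Linf_ereal_norm M u < \<infinity>}"

text \<open>On \<^const>\<open>Linf\<close>, and for a measure that is not identically zero, this is the usual norm.\<close>

definition Linf_norm :: "'a measure \<Rightarrow> ('a \<Rightarrow> 'b::euclidean_space) \<Rightarrow> real" where
  "Linf_norm M u = real_of_ereal (Linf_ereal_norm M u)"

definition essinf :: "'a measure \<Rightarrow> ('a \<Rightarrow> ereal) \<Rightarrow> ereal" where
  "essinf M f = - esssup M (\<lambda>x. - f x)"

text \<open>
  The Lebesgue integral of an extended real function, as the integral of the positive part minus
  the integral of the negative part (\<^const>\<open>e2ennreal\<close> sends negative values to \<open>0\<close>).  It is
  meaningful as soon as one of the two parts has finite integral.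
\<close>

definition ereal_integral :: "'a measure \<Rightarrow> ('a \<Rightarrow> ereal) \<Rightarrow> ereal" where
  "ereal_integral M f =
     enn2ereal (\<integral>\<^sup>+x. e2ennreal (f x) \<partial>M) - enn2ereal (\<integral>\<^sup>+x. e2ennreal (- f x) \<partial>M)"

section \<open>Frechet derivatives on \<open>L\<^sup>\<infinity>\<close>\<close>

definition Linf_bounded_functional ::
    "'a measure \<Rightarrow> (('a \<Rightarrow> 'b::euclidean_space) \<Rightarrow> real) \<Rightarrow> bool" where
  "Linf_bounded_functional M D \<longleftrightarrow>
     (\<forall>u\<in>Linf M. \<forall>w\<in>Linf M. D (\<lambda>x. u x + w x) = D u + D w) \<and>
     (\<forall>c. \<forall>u\<in>Linf M. D (\<lambda>x. c *\<^sub>R u x) = c * D u) \<and>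
     (\<exists>C. \<forall>u\<in>Linf M. \<bar>D u\<bar> \<le> C * Linf_norm M u)"

definition Linf_dual_norm ::
    "'a measure \<Rightarrow> (('a \<Rightarrow> 'b::euclidean_space) \<Rightarrow> real) \<Rightarrow> real" where
  "Linf_dual_norm M D = (SUP u\<in>{u \<in> Linf M. Linf_norm M u \<le> 1}. \<bar>D u\<bar>)"

definition Linf_has_derivative ::
    "'a measure \<Rightarrow> (('a \<Rightarrow> 'b::euclidean_space) \<Rightarrow> real) \<Rightarrow> (('a \<Rightarrow> 'b) \<Rightarrow> real) \<Rightarrow>
     ('a \<Rightarrow> 'b) \<Rightarrow> bool" where
  "Linf_has_derivative M F D u \<longleftrightarrow>
     Linf_bounded_functional M D \<and>
     (\<forall>\<epsilon>>0. \<exists>\<delta>>0. \<forall>h\<in>Linf M. Linf_norm M h < \<delta> \<longrightarrow>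
        \<bar>F (\<lambda>x. u x + h x) - F u - D h\<bar> \<le> \<epsilon> * Linf_norm M h)"

definition Linf_continuously_differentiable_on ::
    "'a measure \<Rightarrow> (('a \<Rightarrow> 'b::euclidean_space) \<Rightarrow> real) \<Rightarrow>
     (('a \<Rightarrow> 'b) \<Rightarrow> ('a \<Rightarrow> 'b) \<Rightarrow> real) \<Rightarrow> ('a \<Rightarrow> 'b) set \<Rightarrow> bool" where
  "Linf_continuously_differentiable_on M F F' A \<longleftrightarrow>
     (\<forall>u\<in>A. Linf_has_derivative M F (F' u) u) \<and>
     (\<forall>u\<in>A. \<forall>\<epsilon>>0. \<exists>\<delta>>0. \<forall>w\<in>A. Linf_norm M (\<lambda>x. w x - u x) < \<delta> \<longrightarrow>
        Linf_dual_norm M (\<lambda>h. F' w h - F' u h) < \<epsilon>)"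

definition Linf_represents ::
    "'a measure \<Rightarrow> ('a \<Rightarrow> 'b::euclidean_space) \<Rightarrow> (('a \<Rightarrow> 'b) \<Rightarrow> real) \<Rightarrow> bool" where
  "Linf_represents M g D \<longleftrightarrow> g \<in> Linf M \<and> (\<forall>q\<in>Linf M. (\<integral>x. g x \<bullet> q x \<partial>M) = D q)"

section \<open>The polytopal Legendre function and its Bregman divergence\<close>

text \<open>
  The columns of \<open>V\<close> are the vertices of the polytope.  The convention \<open>0 ln 0 = 0\<close> holds
  automatically, and the infimum of the empty set is \<open>\<infinity>\<close> in \<^typ>\<open>ereal\<close>.
\<close>

definition polytopal_legendre :: "real^'q^'n \<Rightarrow> real^'n \<Rightarrow> ereal" where
  "polytopal_legendre V x =
     (INF l\<in>{l :: real^'q. (\<forall>i. 0 \<le> l $ i) \<and> (\<Sum>i\<in>UNIV. l $ i) = 1 \<and> V *v l = x}.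
        ereal (\<Sum>i\<in>UNIV. l $ i * ln (l $ i)))"

text \<open>
  The gradient of the real-valued restriction of \<open>R\<close>; meaningful in the interior of the polytope
  only (the value of \<^const>\<open>real_of_ereal\<close> at \<open>\<infinity>\<close> plays no role there).
\<close>

definition grad_legendre :: "real^'q^'n \<Rightarrow> real^'n \<Rightarrow> real^'n" where
  "grad_legendre V q = (THE g. GDERIV (\<lambda>y. real_of_ereal (polytopal_legendre V y)) q :> g)"

definition bregman :: "real^'q^'n \<Rightarrow> real^'n \<Rightarrow> real^'n \<Rightarrow> ereal" where
  "bregman V p q =
     polytopal_legendre V p - polytopal_legendre V q - ereal (grad_legendre V q \<bullet> (p - q))"

section \<open>Constraint sets and objective\<close>

definition constraint_K :: "(real^'d) set \<Rightarrow> (real^'n) set \<Rightarrow> (real^'d \<Rightarrow> real^'n) set" where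
  "constraint_K \<Omega> P = {u \<in> Linf (lebesgue_on \<Omega>). AE x in lebesgue_on \<Omega>. u x \<in> P}"

definition constraint_K_interior ::
    "(real^'d) set \<Rightarrow> (real^'n) set \<Rightarrow> (real^'d \<Rightarrow> real^'n) set" where
  "constraint_K_interior \<Omega> P =
     {u \<in> constraint_K \<Omega> P.
        essinf (lebesgue_on \<Omega>) (\<lambda>x. ereal (infdist (u x) (frontier P))) > 0}"

definition constraint_M ::
    "(real^'d) set \<Rightarrow> real^'n^'r \<Rightarrow> real^'r \<Rightarrow> (real^'d \<Rightarrow> real^'n) set" where
  "constraint_M \<Omega> W b =
     {u \<in> Linf (lebesgue_on \<Omega>). \<forall>i. (\<integral>x. W *v u x \<partial>lebesgue_on \<Omega>) $ i \<le> b $ i}"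

definition constraint_A ::
    "(real^'d) set \<Rightarrow> (real^'n) set \<Rightarrow> real^'n^'r \<Rightarrow> real^'r \<Rightarrow> (real^'d \<Rightarrow> real^'n) set" where
  "constraint_A \<Omega> P W b = constraint_K \<Omega> P \<inter> constraint_M \<Omega> W b"

text \<open>Here \<open>g\<close> is the gradient of \<open>F\<close> at \<open>v\<close>.\<close>

definition objective ::
    "(real^'d) set \<Rightarrow> real^'q^'n \<Rightarrow> real \<Rightarrow> (real^'d \<Rightarrow> real^'n) \<Rightarrow> (real^'d \<Rightarrow> real^'n) \<Rightarrow>
     (real^'d \<Rightarrow> real^'n) \<Rightarrow> ereal" where
  "objective \<Omega> V \<alpha> g v u =
     ereal_integral (lebesgue_on \<Omega>) (\<lambda>x. ereal (\<alpha> * (g x \<bullet> u x)) + bregman V (u x) (v x))"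

end

theory Submission
  imports Defs "HOL-Real_Asymp.Real_Asymp"
begin

text \<open>
  The convex conjugate of \<open>R\<close> is \<open>L(y) = ln (\<Sum>i. exp (y \<bullet> v\<^sub>i))\<close>: Gibbs' inequality for the entropy
  gives \<open>R(p) \<ge> y \<bullet> p - L(y)\<close>, with equality only at the mean \<open>S(y)\<close> of the vertices under the
  weights proportional to \<open>exp (y \<bullet> v\<^sub>i)\<close>.  Moreover \<open>S(y)\<close> is interior to \<open>P\<close> and
  \<open>\<nabla>R(S(y)) = y\<close>.  Put \<open>y = \<nabla>R(v) - \<alpha> \<nabla>F(v)\<close>, a bounded function.  Up to an integrable function that
  does not involve \<open>\<eta>\<close>, the integrand of the objective is the gap
  \<open>R(\<eta>) - (y \<bullet> \<eta> - L(y)) \<ge> 0\<close>, which vanishes exactly when \<open>\<eta> = S(y)\<close>.  So \<open>\<eta> = S \<circ> y\<close> is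
  the unique minimizer; it takes values in the image of a ball under the continuous map \<open>S\<close>, a
  compact subset of the interior of \<open>P\<close>, and \<open>\<nabla>R(\<eta>) = y\<close>.
\<close>

section \<open>Simplex, entropy and Gibbs weights\<close>

definition std_simplex :: "(real^'q) set" where
  "std_simplex = {l. (\<forall>i. 0 \<le> l $ i) \<and> (\<Sum>i\<in>UNIV. l $ i) = 1}"

definition neg_entropy :: "real^'q \<Rightarrow> real" where
  "neg_entropy l = (\<Sum>i\<in>UNIV. l $ i * ln (l $ i))"

definition partition_function :: "real^'q^'n \<Rightarrow> real^'n \<Rightarrow> real" where
  "partition_function V y = (\<Sum>i\<in>UNIV. exp (y \<bullet> column i V))"

definition gibbs_weights :: "real^'q^'n \<Rightarrow> real^'n \<Rightarrow> real^'q" where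
  "gibbs_weights V y = (\<chi> i. exp (y \<bullet> column i V) / partition_function V y)"

text \<open>This is the gradient of \<open>ln (partition_function V y)\<close> with respect to
  \<open>y\<close>, so by convex duality it is the natural candidate for the inverse of the gradient
  map of \<open>R\<close>.\<close>

definition gibbs_mean :: "real^'q^'n \<Rightarrow> real^'n \<Rightarrow> real^'n" where
  "gibbs_mean V y = V *v gibbs_weights V y"

section \<open>Attainment and measurability of \<open>R\<close>\<close>

lemma polytopal_legendre_eq:
  "polytopal_legendre V x = (INF l\<in>{l \<in> std_simplex. V *v l = x}. ereal (neg_entropy l))"
  by (simp add: polytopal_legendre_def std_simplex_def neg_entropy_def conj_assoc)

lemma inner_matrix_vector_column:
  fixes V :: "real^'q^'n"
  shows "y \<bullet> (V *v l) = (\<Sum>i\<in>UNIV. l $ i * (y \<bullet> column i V))"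
  by (simp add: matrix_mult_sum inner_sum_right scalar_mult_eq_scaleR)

text \<open>Only the endpoint needs an argument: \<open>x * ln x\<close> tends to 0 from the right,
  which agrees with the value \<open>0 * ln 0 = 0\<close>.\<close>

lemma continuous_on_mult_ln: "continuous_on {0..} (\<lambda>x::real. x * ln x)"
  unfolding continuous_on_def
proof -
  show "\<forall>x\<in>{0..}. ((\<lambda>x::real. x * ln x) \<longlongrightarrow> x * ln x) (at x within {0..})"
  proof
    fix x :: real assume "x \<in> {0..}"
    show "((\<lambda>x::real. x * ln x) \<longlongrightarrow> x * ln x) (at x within {0..})"
    proof (cases "x = 0")
      case True
      have "((\<lambda>x::real. x * ln x) \<longlongrightarrow> 0) (at_right 0)" by real_asymp
      moreover have "at (0::real) within {0..} = at_right 0"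
        by (rule at_within_nhd[of _ UNIV]) auto
      ultimately show ?thesis using True by simp
    next
      case False
      then show ?thesis by (intro tendsto_intros) auto
    qed
  qed
qed

lemma continuous_on_neg_entropy: "continuous_on std_simplex neg_entropy"
proof -
  have "continuous_on std_simplex (\<lambda>l::real^'q. l $ i * ln (l $ i))" for i
    by (rule continuous_on_compose2[OF continuous_on_mult_ln])
       (auto simp: std_simplex_def intro!: continuous_intros)
  then show ?thesis
    unfolding neg_entropy_def by (intro continuous_on_sum)
qed

lemma compact_std_simplex: "compact (std_simplex :: (real^'q) set)"
proof -
  have "closed (std_simplex :: (real^'q) set)"
    unfolding std_simplex_def
    by (intro closed_Collect_conj closed_Collect_all closed_Collect_le closed_Collect_eq
        continuous_intros)
  moreover have "norm l \<le> 1" if "l \<in> std_simplex" for l :: "real^'q"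
    using norm_le_l1_cart[of l] that by (simp add: std_simplex_def)
  then have "bounded (std_simplex :: (real^'q) set)"
    unfolding bounded_iff by blast
  ultimately show ?thesis by (simp add: compact_eq_bounded_closed)
qed

text \<open>Connects two descriptions of the polytope: estimates of \<open>R\<close> work with
  weights in the simplex, while the hypothesis on the vertices speaks of the columns. The basis
  vectors \<open>axis i 1\<close> are the weights that produce the columns.\<close>

lemma std_simplex_image_eq_hull:
  fixes V :: "real^'q^'n"
  shows "(*v) V ` std_simplex = convex hull (range (\<lambda>i. column i V))"
proof
  show "(*v) V ` std_simplex \<subseteq> convex hull (range (\<lambda>i. column i V))"
  proof clarify
    fix l :: "real^'q" assume l: "l \<in> std_simplex"
    have "(\<Sum>i\<in>UNIV. l $ i *\<^sub>R column i V) \<in> convex hull (range (\<lambda>i. column i V))"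
      using l by (intro convex_sum) (auto simp: std_simplex_def hull_inc)
    then show "V *v l \<in> convex hull (range (\<lambda>i. column i V))"
      by (simp add: matrix_mult_sum scalar_mult_eq_scaleR)
  qed
  show "convex hull (range (\<lambda>i. column i V)) \<subseteq> (*v) V ` std_simplex"
  proof (rule hull_minimal)
    have "column i V \<in> (*v) V ` std_simplex" for i
      by (rule image_eqI[of _ _ "axis i 1"])
         (auto simp: std_simplex_def axis_def matrix_vector_mult_def column_def vec_eq_iff
           if_distrib[of "\<lambda>t. _ * t"] cong: if_cong)
    then show "range (\<lambda>i. column i V) \<subseteq> (*v) V ` std_simplex" by blast
    have "convex (std_simplex :: (real^'q) set)"
      unfolding convex_def std_simplex_def
      by (auto simp: sum.distrib sum_distrib_left[symmetric])
    then show "convex ((*v) V ` std_simplex)"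
      by (rule convex_linear_image[OF matrix_vector_mul_linear])
  qed
qed

text \<open>The weights representing \<open>x\<close> form a compact set on which the entropy is
  continuous, so the infimum is a minimum. Statements about \<open>R\<close> on the polytope thereby
  become statements about one weight vector.\<close>

lemma polytopal_legendre_attained:
  assumes "x \<in> (*v) V ` std_simplex"
  obtains l where "l \<in> std_simplex" "V *v l = x" "polytopal_legendre V x = ereal (neg_entropy l)"
proof -
  let ?S = "{l \<in> std_simplex. V *v l = x}"
  have "?S = std_simplex \<inter> {l. V *v l = x}" by auto
  moreover have "closed {l. V *v l = x}"
    by (intro closed_Collect_eq continuous_intros linear_continuous_on_compose[of _ id, simplified]
        matrix_vector_mul_linear linear_continuous_on matrix_vector_mul_bounded_linear)
  ultimately have "compact ?S"
    by (simp add: compact_Int_closed compact_std_simplex)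
  moreover have "?S \<noteq> {}" using assms by auto
  moreover have "continuous_on ?S neg_entropy"
    by (rule continuous_on_subset[OF continuous_on_neg_entropy]) auto
  ultimately obtain l where l: "l \<in> ?S" "\<And>l'. l' \<in> ?S \<Longrightarrow> neg_entropy l \<le> neg_entropy l'"
    using continuous_attains_inf[of ?S neg_entropy] by blast
  have "polytopal_legendre V x = ereal (neg_entropy l)"
    unfolding polytopal_legendre_eq
    by (rule antisym) (use l in \<open>auto intro!: INF_lower INF_greatest\<close>)
  with l that show thesis by auto
qed

lemma polytopal_legendre_outside:
  assumes "x \<notin> (*v) V ` std_simplex"
  shows "polytopal_legendre V x = \<infinity>"
proof -
  have "{l \<in> std_simplex. V *v l = x} = {}" using assms by auto
  then show ?thesis unfolding polytopal_legendre_eq by (simp only: image_empty Inf_empty top_ereal_def)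
qed

lemma polytopal_legendre_le:
  assumes "l \<in> std_simplex"
  shows "polytopal_legendre V (V *v l) \<le> ereal (neg_entropy l)"
  unfolding polytopal_legendre_eq by (rule INF_lower) (use assms in auto)

text \<open>Sublevel sets are images of compact sets, so \<open>R\<close> is lower semicontinuous.\<close>

lemma borel_measurable_polytopal_legendre:
  fixes V :: "real^'q^'n"
  shows "polytopal_legendre V \<in> borel_measurable borel"
proof (rule borel_measurableI_le)
  fix c :: ereal
  show "{x \<in> space borel. polytopal_legendre V x \<le> c} \<in> sets borel"
  proof (cases "c = \<infinity>")
    case True
    then show ?thesis by simp
  next
    case False
    let ?S = "{l :: real^'q. l \<in> std_simplex \<and> ereal (neg_entropy l) \<le> c}"
    \<comment> \<open>Attainment gives the inclusion from left to right: minimizing weights for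
      \<open>x\<close> have entropy at most \<open>c\<close>. For \<open>c = \<infinity>\<close> the
      sublevel set also contains the points off the polytope, which is why that case is
      separate.\<close>
    have "{x. polytopal_legendre V x \<le> c} = (*v) V ` ?S"
    proof (intro set_eqI iffI)
      fix x assume x: "x \<in> {x. polytopal_legendre V x \<le> c}"
      then have "x \<in> (*v) V ` std_simplex"
        using False polytopal_legendre_outside[of x V] by fastforce
      then show "x \<in> (*v) V ` ?S"
        using x by (auto elim!: polytopal_legendre_attained)
    next
      fix x assume "x \<in> (*v) V ` ?S"
      then show "x \<in> {x. polytopal_legendre V x \<le> c}"
        using polytopal_legendre_le order_trans by blast
    qed
    moreover have "compact ?S"
    proof -
      have "continuous_on std_simplex (\<lambda>l::real^'q. ereal (neg_entropy l))"
        by (intro continuous_intros continuous_on_neg_entropy)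
      then have "closed ((std_simplex :: (real^'q) set) \<inter> (\<lambda>l. ereal (neg_entropy l)) -` {..c})"
        by (rule continuous_closed_preimage) (simp_all add: compact_imp_closed compact_std_simplex)
      moreover have "std_simplex \<inter> (\<lambda>l::real^'q. ereal (neg_entropy l)) -` {..c} = ?S" by auto
      ultimately have "closed ?S" by (simp only:)
      then have "compact (std_simplex \<inter> ?S)"
        by (rule compact_Int_closed[OF compact_std_simplex])
      moreover have "std_simplex \<inter> ?S = ?S" by auto
      ultimately show ?thesis by simp
    qed
    then have "compact ((*v) V ` ?S)"
      by (intro compact_continuous_image matrix_vector_mult_linear_continuous_on)
    ultimately show ?thesis by (simp add: borel_compact)
  qed
qed

section \<open>Gibbs' inequality and the affine minorants of \<open>R\<close>\<close>

lemma partition_function_pos: "0 < partition_function V y"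
  unfolding partition_function_def by (intro sum_pos) auto

lemma gibbs_weights_pos: "0 < gibbs_weights V y $ i"
  by (simp add: gibbs_weights_def partition_function_pos)

lemma gibbs_weights_in_std_simplex: "gibbs_weights V y \<in> std_simplex"
  using partition_function_pos[of V y]
  by (simp add: std_simplex_def gibbs_weights_def less_imp_le flip: sum_divide_distrib)
     (simp add: partition_function_def)

lemma ln_gibbs_weights:
  "ln (gibbs_weights V y $ i) = y \<bullet> column i V - ln (partition_function V y)"
  using partition_function_pos[of V y] by (simp add: gibbs_weights_def ln_div)

text \<open>For \<open>a > 0\<close> this is \<open>ln s \<le> s - 1\<close> at
  \<open>s = b / a\<close>, with equality only at \<open>s = 1\<close>. The terms
  \<open>a - b\<close> make the inequality hold coordinate by coordinate and cancel when summed over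
  two probability vectors.\<close>

lemma mult_ln_ge:
  fixes a b :: real
  assumes "0 \<le> a" "0 < b"
  shows "a * ln b + a - b \<le> a * ln a"
    and "a * ln a = a * ln b + a - b \<Longrightarrow> a = b"
proof -
  have *: "a * ln b + a - b = a * ln a + a * (ln (b / a) - (b / a - 1))" if "a > 0"
    using that assms by (simp add: ln_div field_simps)
  show "a * ln b + a - b \<le> a * ln a"
  proof (cases "a = 0")
    case False
    then have "a * (ln (b / a) - (b / a - 1)) \<le> 0"
      using assms ln_le_minus_one[of "b / a"] by (intro mult_nonneg_nonpos) auto
    with * False assms show ?thesis by simp
  qed (use assms in simp)
  show "a = b" if "a * ln a = a * ln b + a - b"
  proof (cases "a = 0")
    case False
    then have "ln (b / a) = b / a - 1" using * that assms by simp
    then have "b / a = 1" using assms False by (intro ln_eq_minus_one) auto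
    then show ?thesis using False by simp
  qed (use that in simp)
qed

text \<open>The difference of the two sides is the Kullback-Leibler divergence of \<open>l\<close>
  from the Gibbs weights \<open>?s\<close>, because \<open>ln (?s $ i)\<close> is
  \<open>y \<bullet> column i V\<close> up to a constant. It is written as a sum of nonnegative
  terms \<open>?d i\<close>, each vanishing only when the coordinates agree.\<close>

lemma neg_entropy_gibbs:
  assumes "l \<in> std_simplex"
  shows "y \<bullet> (V *v l) - ln (partition_function V y) \<le> neg_entropy l"
    and "neg_entropy l = y \<bullet> (V *v l) - ln (partition_function V y) \<longleftrightarrow> l = gibbs_weights V y"
proof -
  let ?s = "gibbs_weights V y"
  let ?d = "\<lambda>i. l $ i * ln (l $ i) - (l $ i * ln (?s $ i) + l $ i - ?s $ i)"
  have sums: "(\<Sum>i\<in>UNIV. l $ i) = 1" "(\<Sum>i\<in>UNIV. ?s $ i) = 1"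
    using assms gibbs_weights_in_std_simplex[of V y] by (auto simp: std_simplex_def)
  have "(\<Sum>i\<in>UNIV. l $ i * ln (?s $ i)) = y \<bullet> (V *v l) - ln (partition_function V y)"
    using sums by (simp add: ln_gibbs_weights inner_matrix_vector_column right_diff_distrib
        sum_subtractf flip: sum_distrib_right)
  then have eq: "neg_entropy l - (y \<bullet> (V *v l) - ln (partition_function V y)) = (\<Sum>i\<in>UNIV. ?d i)"
    using sums by (simp add: neg_entropy_def sum_subtractf sum.distrib)
  have nonneg: "0 \<le> ?d i" for i
    using mult_ln_ge(1)[of "l $ i" "?s $ i"] assms gibbs_weights_pos[of V y i]
    by (simp add: std_simplex_def)
  have "0 \<le> (\<Sum>i\<in>UNIV. ?d i)" by (intro sum_nonneg nonneg)
  with eq show "y \<bullet> (V *v l) - ln (partition_function V y) \<le> neg_entropy l" by linarith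
  have zero: "?d i = 0 \<longleftrightarrow> l $ i = ?s $ i" for i
    using mult_ln_ge(2)[of "l $ i" "?s $ i"] assms gibbs_weights_pos[of V y i]
    by (auto simp: std_simplex_def)
  have "neg_entropy l = y \<bullet> (V *v l) - ln (partition_function V y) \<longleftrightarrow> (\<Sum>i\<in>UNIV. ?d i) = 0"
    using eq by linarith
  also have "\<dots> \<longleftrightarrow> (\<forall>i. ?d i = 0)"
    by (subst sum_nonneg_eq_0_iff) (use nonneg in auto)
  also have "\<dots> \<longleftrightarrow> l = ?s"
    unfolding zero vec_eq_iff ..
  finally show "neg_entropy l = y \<bullet> (V *v l) - ln (partition_function V y) \<longleftrightarrow> l = ?s" .
qed

text \<open>The Fenchel-Young inequality. Gibbs' lower bound depends on the weights only through
  \<open>V *v l\<close>, so it applies to the minimizing weights of \<open>p\<close>.\<close>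

lemma polytopal_legendre_ge_affine:
  "ereal (y \<bullet> p - ln (partition_function V y)) \<le> polytopal_legendre V p"
proof (cases "p \<in> (*v) V ` std_simplex")
  case True
  then obtain l where "l \<in> std_simplex" "V *v l = p" "polytopal_legendre V p = ereal (neg_entropy l)"
    by (rule polytopal_legendre_attained)
  then show ?thesis using neg_entropy_gibbs(1)[of l y V] by simp
qed (simp add: polytopal_legendre_outside)

text \<open>Equality forces the minimizing weights of \<open>p\<close> to be the Gibbs weights, and
  these determine \<open>p\<close>. This is the source of the uniqueness of the minimizer.\<close>

lemma polytopal_legendre_eq_affine_iff:
  "polytopal_legendre V p = ereal (y \<bullet> p - ln (partition_function V y)) \<longleftrightarrow> p = gibbs_mean V y"
proof
  assume eq: "polytopal_legendre V p = ereal (y \<bullet> p - ln (partition_function V y))"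
  then have "p \<in> (*v) V ` std_simplex"
    using polytopal_legendre_outside[of p V] by fastforce
  then obtain l where l: "l \<in> std_simplex" "V *v l = p"
    "polytopal_legendre V p = ereal (neg_entropy l)"
    by (rule polytopal_legendre_attained)
  then have "l = gibbs_weights V y" using neg_entropy_gibbs(2)[of l y V] eq by simp
  with l show "p = gibbs_mean V y" by (simp add: gibbs_mean_def)
next
  assume p: "p = gibbs_mean V y"
  then have "polytopal_legendre V p \<le> ereal (y \<bullet> p - ln (partition_function V y))"
    using polytopal_legendre_le[OF gibbs_weights_in_std_simplex]
      neg_entropy_gibbs(2)[OF gibbs_weights_in_std_simplex, of V y y V]
    by (metis gibbs_mean_def)
  then show "polytopal_legendre V p = ereal (y \<bullet> p - ln (partition_function V y))"
    using polytopal_legendre_ge_affine antisym by blast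
qed

lemma continuous_on_partition_function [continuous_intros]:
  "continuous_on A (partition_function V)"
  unfolding partition_function_def by (intro continuous_intros)

lemma continuous_on_gibbs_mean: "continuous_on A (gibbs_mean V)"
proof -
  have "continuous_on A (gibbs_weights V)"
    unfolding gibbs_weights_def
    by (intro continuous_intros) (metis less_irrefl partition_function_pos)
  then show ?thesis
    unfolding gibbs_mean_def
    using continuous_on_compose2[OF matrix_vector_mult_linear_continuous_on[of UNIV V]] by blast
qed

section \<open>Interior points and the gradient of \<open>R\<close>\<close>

text \<open>Two points of a ball inside the polytope that differ by a multiple of
  \<open>axis j 1\<close> have weights whose difference sums to 0 and is mapped to that multiple.
  Rescaling and extending linearly gives \<open>B\<close>, which lifts a displacement of the point
  to a displacement of its weights.\<close>

lemma zero_sum_right_inverse: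
  fixes V :: "real^'q^'n"
  assumes "interior ((*v) V ` std_simplex) \<noteq> {}"
  obtains B :: "real^'n \<Rightarrow> real^'q"
  where "linear B" "\<And>h. V *v B h = h" "\<And>h. (\<Sum>i\<in>UNIV. B h $ i) = 0"
proof -
  obtain p r where r: "0 < r" "ball p r \<subseteq> (*v) V ` std_simplex"
    using assms by (auto simp: mem_interior)
  have "\<exists>m. V *v m = axis j 1 \<and> (\<Sum>i\<in>UNIV. m $ i) = 0" for j :: 'n
  proof -
    have "p \<in> ball p r" "p + (r/2) *\<^sub>R axis j 1 \<in> ball p r"
      using r by (auto simp: dist_norm)
    then have *: "p \<in> (*v) V ` std_simplex" "p + (r/2) *\<^sub>R axis j 1 \<in> (*v) V ` std_simplex"
      using r(2) by blast+
    obtain l where l: "p = V *v l" "l \<in> std_simplex"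
      using *(1) by (rule imageE)
    obtain l' where l': "p + (r/2) *\<^sub>R axis j 1 = V *v l'" "l' \<in> std_simplex"
      using *(2) by (rule imageE)
    have "V *v ((2/r) *\<^sub>R (l' - l)) = axis j 1"
      using r by (simp add: matrix_vector_mult_diff_distrib matrix_vector_mult_scaleR flip: l(1) l'(1))
    moreover have "(\<Sum>i\<in>UNIV. ((2/r) *\<^sub>R (l' - l)) $ i) = 0"
      using l(2) l'(2)
      by (simp add: std_simplex_def sum_subtractf flip: sum_distrib_left sum_divide_distrib)
    ultimately show ?thesis by blast
  qed
  then obtain m where m: "\<And>j. V *v m j = axis j 1" "\<And>j. (\<Sum>i\<in>UNIV. m j $ i) = 0"
    by metis
  define B where "B h = (\<Sum>j\<in>UNIV. h $ j *\<^sub>R m j)" for h :: "real^'n"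
  show thesis
  proof
    show "linear B"
      unfolding B_def by (rule linearI)
        (simp_all add: scaleR_add_left sum.distrib scaleR_sum_right)
    show "V *v B h = h" for h
      using basis_expansion[of h]
      by (simp add: B_def m vec.sum matrix_vector_mult_scaleR scalar_mult_eq_scaleR)
    show "(\<Sum>i\<in>UNIV. B h $ i) = 0" for h
      unfolding B_def by (simp, subst sum.swap) (simp add: m flip: sum_distrib_left)
  qed
qed

text \<open>Gibbs weights are strictly positive, so small changes keep them positive, and the zero
  sum of \<open>B h\<close> preserves the total weight 1.\<close>

lemma gibbs_weights_perturb:
  fixes B :: "real^'n \<Rightarrow> real^'q"
  assumes "linear B" "\<And>h. (\<Sum>i\<in>UNIV. B h $ i) = 0"
  shows "\<forall>\<^sub>F h in nhds 0. gibbs_weights V y + B h \<in> std_simplex"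
proof -
  let ?s = "gibbs_weights V y"
  have "\<forall>\<^sub>F h in nhds 0. 0 < (?s + B h) $ i" for i
  proof -
    have "((\<lambda>h. (?s + B h) $ i) \<longlongrightarrow> (?s + B 0) $ i) (nhds 0)"
      using linear_continuous_at[OF linear_conv_bounded_linear[THEN iffD1, OF assms(1)], of 0]
      by (intro tendsto_intros) (simp add: continuous_at tendsto_nhds_iff)
    moreover have "0 < (?s + B 0) $ i" by (simp add: linear_0[OF assms(1)] gibbs_weights_pos)
    ultimately show ?thesis by (rule order_tendstoD(1))
  qed
  then have "\<forall>\<^sub>F h in nhds 0. \<forall>i. 0 < (?s + B h) $ i"
    by (rule eventually_all_finite)
  then show ?thesis
  proof eventually_elim
    case (elim h)
    then show ?case
      using gibbs_weights_in_std_simplex[of V y] assms(2)[of h]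
      by (auto simp: std_simplex_def sum.distrib less_imp_le)
  qed
qed

text \<open>Every \<open>p\<close> near the Gibbs mean is represented by the Gibbs weights shifted
  by \<open>B (p - gibbs_mean V y)\<close>.\<close>

lemma gibbs_mean_in_interior:
  fixes V :: "real^'q^'n"
  assumes "interior ((*v) V ` std_simplex) \<noteq> {}"
  shows "gibbs_mean V y \<in> interior ((*v) V ` std_simplex)"
proof -
  obtain B where B: "linear B" "\<And>h. V *v B h = h" "\<And>h. (\<Sum>i\<in>UNIV. B h $ i) = 0"
    using zero_sum_right_inverse[OF assms] by blast
  obtain e where e: "0 < e" "\<And>h. norm h < e \<Longrightarrow> gibbs_weights V y + B h \<in> std_simplex"
    using gibbs_weights_perturb[OF B(1,3), of V y] by (auto simp: eventually_nhds_metric dist_norm)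
  have "ball (gibbs_mean V y) e \<subseteq> (*v) V ` std_simplex"
  proof
    fix p assume "p \<in> ball (gibbs_mean V y) e"
    then have "gibbs_weights V y + B (p - gibbs_mean V y) \<in> std_simplex"
      by (intro e) (simp add: dist_norm norm_minus_commute)
    moreover have "V *v (gibbs_weights V y + B (p - gibbs_mean V y)) = p"
      by (simp add: matrix_vector_right_distrib B gibbs_mean_def)
    ultimately show "p \<in> (*v) V ` std_simplex" by (metis imageI)
  qed
  with e(1) show ?thesis by (auto simp: mem_interior)
qed

text \<open>
  Near \<open>gibbs_mean V y\<close> the function \<open>R\<close> lies between its affine minorant with slope \<open>y\<close> and the
  entropy of perturbed Gibbs weights, which have the same value and derivative at that point.
\<close>

lemma GDERIV_polytopal_legendre:
  fixes V :: "real^'q^'n"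
  assumes "interior ((*v) V ` std_simplex) \<noteq> {}"
  shows "GDERIV (\<lambda>p. real_of_ereal (polytopal_legendre V p)) (gibbs_mean V y) :> y"
proof -
  let ?f = "\<lambda>p. real_of_ereal (polytopal_legendre V p)" and ?p = "gibbs_mean V y"
    and ?s = "gibbs_weights V y"
  obtain B where B: "linear B" "\<And>h. V *v B h = h" "\<And>h. (\<Sum>i\<in>UNIV. B h $ i) = 0"
    using zero_sum_right_inverse[OF assms] by blast
  define e where "e h = neg_entropy (?s + B h)" for h
  have B_lin: "bounded_linear (\<lambda>h. B h $ i)" for i
    using B(1) linear_conv_bounded_linear bounded_linear_compose[OF bounded_linear_vec_nth]
    by blast
  have "(e has_derivative (\<lambda>h. \<Sum>i\<in>UNIV. (ln (?s $ i) + 1) * (B h $ i))) (at 0)"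
    unfolding e_def neg_entropy_def
  proof (rule has_derivative_sum)
    fix i
    have "((\<lambda>h. (?s + B h) $ i) has_derivative (\<lambda>h. B h $ i)) (at 0)"
      using has_derivative_add[OF has_derivative_const
          bounded_linear_imp_has_derivative[OF B_lin[of i]], of "?s $ i"] by simp
    moreover have "((\<lambda>x. x * ln x) has_field_derivative ln (?s $ i) + 1) (at ((?s + B 0) $ i))"
      using gibbs_weights_pos[of V y i]
      by (auto intro!: derivative_eq_intros simp: linear_0[OF B(1)])
    ultimately show "((\<lambda>h. (?s + B h) $ i * ln ((?s + B h) $ i)) has_derivative
        (\<lambda>h. (ln (?s $ i) + 1) * (B h $ i))) (at 0)"
      by (auto dest: DERIV_compose_FDERIV simp: mult.commute)
  qed
  \<comment> \<open>Both the summand 1 and the logarithm of the partition function are constant in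
    \<open>i\<close>, so they multiply the zero sum of \<open>B h\<close> and drop out.\<close>
  moreover have "(\<Sum>i\<in>UNIV. (ln (?s $ i) + 1) * (B h $ i)) = h \<bullet> y" for h
  proof -
    have "(\<Sum>i\<in>UNIV. (ln (?s $ i) + 1) * (B h $ i)) =
        (\<Sum>i\<in>UNIV. B h $ i * (y \<bullet> column i V))
          + (1 - ln (partition_function V y)) * (\<Sum>i\<in>UNIV. B h $ i)"
      unfolding sum_distrib_left
      by (simp add: ln_gibbs_weights algebra_simps flip: sum.distrib)
    also have "\<dots> = y \<bullet> (V *v B h)"
      by (simp add: B(3) inner_matrix_vector_column)
    finally show ?thesis by (simp add: B(2) inner_commute)
  qed
  ultimately have "(e has_derivative (\<lambda>h. h \<bullet> y)) (at 0)" by simp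
  then have lim: "(\<lambda>h. norm (e h - e 0 - h \<bullet> y) / norm h) \<midarrow>0\<rightarrow> 0"
    by (simp add: has_derivative_at)
  have f_p: "?f ?p = y \<bullet> ?p - ln (partition_function V y)"
    using polytopal_legendre_eq_affine_iff[of V ?p y] by simp
  have e_0: "e 0 = ?f ?p"
    using neg_entropy_gibbs(2)[OF gibbs_weights_in_std_simplex, of V y y V] f_p
    by (simp add: e_def linear_0[OF B(1)] gibbs_mean_def)
  \<comment> \<open>The affine minorant makes the remainder of \<open>?f\<close> nonnegative, so its
    norm is bounded by the remainder of \<open>e\<close>.\<close>
  have upper: "\<forall>\<^sub>F h in at 0. norm (?f (?p + h) - ?f ?p - h \<bullet> y) / norm h
      \<le> norm (e h - e 0 - h \<bullet> y) / norm h"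
    using gibbs_weights_perturb[OF B(1,3), of V y, THEN filter_leD[OF at_within_le_nhds]]
  proof eventually_elim
    case (elim h)
    have mem: "V *v (?s + B h) = ?p + h"
      by (simp add: matrix_vector_right_distrib B gibbs_mean_def)
    then have "?p + h \<in> (*v) V ` std_simplex" using elim by (metis imageI)
    then obtain l where "l \<in> std_simplex" "V *v l = ?p + h"
      and l: "polytopal_legendre V (?p + h) = ereal (neg_entropy l)"
      by (rule polytopal_legendre_attained)
    have "?f (?p + h) \<le> e h"
      using polytopal_legendre_le[OF elim, of V] l by (simp add: mem e_def)
    moreover have "y \<bullet> (?p + h) - ln (partition_function V y) \<le> ?f (?p + h)"
      using polytopal_legendre_ge_affine[of y "?p + h" V] l by simp
    ultimately show ?case
      using e_0 f_p by (intro divide_right_mono) (auto simp: inner_add_right inner_commute)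
  qed
  have "(\<lambda>h. norm (?f (?p + h) - ?f ?p - h \<bullet> y) / norm h) \<midarrow>0\<rightarrow> 0"
    by (rule tendsto_sandwich[OF _ upper tendsto_const lim])
       (intro always_eventually allI divide_nonneg_nonneg norm_ge_zero)
  then show ?thesis
    by (simp add: gderiv_def has_derivative_at bounded_linear_inner_left)
qed

text \<open>Uniqueness of the Frechet derivative resolves the definite description. The boundedness
  of the gradient at the minimizer thus reduces to that of the slope \<open>y\<close>.\<close>

lemma grad_legendre_gibbs_mean:
  fixes V :: "real^'q^'n"
  assumes "interior ((*v) V ` std_simplex) \<noteq> {}"
  shows "grad_legendre V (gibbs_mean V y) = y"
  unfolding grad_legendre_def
proof (rule the_equality)
  show "GDERIV (\<lambda>p. real_of_ereal (polytopal_legendre V p)) (gibbs_mean V y) :> y"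
    by (rule GDERIV_polytopal_legendre[OF assms])
  fix g assume "GDERIV (\<lambda>p. real_of_ereal (polytopal_legendre V p)) (gibbs_mean V y) :> g"
  then have "(\<lambda>h. h \<bullet> g) = (\<lambda>h. h \<bullet> y)"
    unfolding gderiv_def
    by (rule has_derivative_unique[OF _ GDERIV_polytopal_legendre[OF assms, unfolded gderiv_def]])
  then have "\<forall>h. h \<bullet> g = h \<bullet> y" by (rule fun_cong[THEN allI])
  then show "g = y" by (simp only: vector_eq_ldot)
qed

text \<open>The distance to the frontier is continuous and positive along the Gibbs means, so it has
  a positive minimum over a compact ball of slopes.\<close>

lemma gibbs_mean_ball_away_from_frontier:
  fixes V :: "real^'q^'n"
  assumes "interior ((*v) V ` std_simplex) \<noteq> {}"
  obtains d where "0 < d"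
    "\<And>y. norm y \<le> r \<Longrightarrow> d \<le> infdist (gibbs_mean V y) (frontier ((*v) V ` std_simplex))"
proof -
  let ?P = "(*v) V ` std_simplex"
  let ?d = "\<lambda>y. infdist (gibbs_mean V y) (frontier ?P)"
  have "compact ?P"
    by (intro compact_continuous_image matrix_vector_mult_linear_continuous_on compact_std_simplex)
  \<comment> \<open>\<open>infdist\<close> to the empty set is 0 by convention, so positivity
    requires a nonempty frontier; a bounded set with interior points has one.\<close>
  then have "frontier ?P \<noteq> {}"
    using assms not_bounded_UNIV by (auto simp: frontier_eq_empty compact_imp_bounded)
  moreover have "gibbs_mean V y \<notin> frontier ?P" for y
    using gibbs_mean_in_interior[OF assms, of y] by (simp add: frontier_def)
  ultimately have pos: "0 < ?d y" for y
    by (intro infdist_pos_not_in_closed) auto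
  \<comment> \<open>The radius \<open>\<bar>r\<bar>\<close> keeps the ball nonempty when
    \<open>r\<close> is negative.\<close>
  have "\<exists>y0\<in>cball 0 \<bar>r\<bar>. \<forall>y\<in>cball 0 \<bar>r\<bar>. ?d y0 \<le> ?d y"
    by (intro continuous_attains_inf continuous_intros continuous_on_gibbs_mean) auto
  then obtain y0 where "\<forall>y\<in>cball 0 \<bar>r\<bar>. ?d y0 \<le> ?d y" by blast
  then have "?d y0 \<le> ?d y" if "norm y \<le> r" for y using that by simp
  with pos[of y0] show thesis by (rule that)
qed

section \<open>Bounded functions and extended real integrals\<close>

lemma LinfE:
  assumes "u \<in> Linf M"
  obtains C where "0 \<le> C" "AE x in M. norm (u x) \<le> C"
proof -
  have "esssup M (\<lambda>x. ereal (norm (u x))) < \<infinity>"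
    using assms by (simp add: Linf_def Linf_ereal_norm_def)
  then obtain C where "esssup M (\<lambda>x. ereal (norm (u x))) \<le> ereal C"
    using ereal_dense2 less_imp_le by blast
  \<comment> \<open>The maximum with 0 secures a nonnegative bound: the essential supremum is
    \<open>-\<infinity>\<close> when the measure is zero.\<close>
  then have "AE x in M. norm (u x) \<le> max C 0"
    by (intro eventually_mono[OF esssup_AE[of "\<lambda>x. ereal (norm (u x))" M]])
       (auto dest: order_trans)
  with that[of "max C 0"] show thesis by simp
qed

lemma LinfI:
  assumes [measurable]: "u \<in> borel_measurable M" and "AE x in M. norm (u x) \<le> C"
  shows "u \<in> Linf M"
proof -
  have "esssup M (\<lambda>x. ereal (norm (u x))) \<le> ereal C"
    by (rule esssup_I) (use assms(2) in auto)
  then show ?thesis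
    by (auto simp: Linf_def Linf_ereal_norm_def intro: le_less_trans)
qed

lemma Linf_measurable [measurable_dest]: "u \<in> Linf M \<Longrightarrow> u \<in> borel_measurable M"
  by (simp add: Linf_def)

lemma Linf_diff:
  assumes "u \<in> Linf M" "w \<in> Linf M"
  shows "(\<lambda>x. u x - w x) \<in> Linf M"
proof -
  obtain C D where "AE x in M. norm (u x) \<le> C" "AE x in M. norm (w x) \<le> D"
    using assms by (metis LinfE)
  then have "AE x in M. norm (u x - w x) \<le> C + D"
    by eventually_elim (meson add_mono norm_triangle_ineq4 order_trans)
  with assms show ?thesis by (intro LinfI) auto
qed

lemma Linf_scaleR:
  assumes "u \<in> Linf M"
  shows "(\<lambda>x. c *\<^sub>R u x) \<in> Linf M"
proof -
  obtain C where "AE x in M. norm (u x) \<le> C"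
    using assms by (metis LinfE)
  then have "AE x in M. norm (c *\<^sub>R u x) \<le> \<bar>c\<bar> * C"
    by eventually_elim (simp add: mult_left_mono)
  with assms show ?thesis by (intro LinfI) auto
qed

text \<open>
  The identity \<open>(c + D)\<^sup>+ + c\<^sup>- = (c + D)\<^sup>- + c\<^sup>+ + D\<close> avoids subtracting infinities.
\<close>

lemma ereal_integral_add_nonneg:
  fixes c :: "'a \<Rightarrow> real" and D :: "'a \<Rightarrow> ennreal"
  assumes c: "integrable M c" and [measurable]: "D \<in> borel_measurable M"
  shows "ereal_integral M (\<lambda>x. ereal (c x) + enn2ereal (D x)) =
    ereal (integral\<^sup>L M c) + enn2ereal (integral\<^sup>N M D)"
proof -
  let ?f = "\<lambda>x. ereal (c x) + enn2ereal (D x)"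
  define fp fm where "fp = (\<integral>\<^sup>+x. e2ennreal (?f x) \<partial>M)" and "fm = (\<integral>\<^sup>+x. e2ennreal (- ?f x) \<partial>M)"
  define cp cm where "cp = (\<integral>\<^sup>+x. ennreal (c x) \<partial>M)" and "cm = (\<integral>\<^sup>+x. ennreal (- c x) \<partial>M)"
  have [measurable]: "c \<in> borel_measurable M" using c by simp
  have fin: "cp < \<infinity>" "cm < \<infinity>" and int: "integral\<^sup>L M c = enn2real cp - enn2real cm"
    using c by (auto simp: cp_def cm_def real_integrable_def real_lebesgue_integral_def less_top)
  have "e2ennreal (?f x) + ennreal (- c x) = e2ennreal (- ?f x) + (ennreal (c x) + D x)" for x
  proof (cases "D x")
    case (real r)
    then have "?f x = ereal (c x + r)" by (simp add: enn2ereal_ennreal)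
    then show ?thesis using real
      by (cases "0 \<le> c x"; cases "0 \<le> c x + r")
         (auto simp: ennreal_neg simp flip: ennreal_plus)
  qed simp
  then have eq: "fp + cm = fm + (cp + integral\<^sup>N M D)"
    unfolding fp_def fm_def cp_def cm_def by (simp flip: nn_integral_add)
  \<comment> \<open>Since \<open>D\<close> is nonnegative, adding it can only shrink the negative
    part; hence \<open>fm\<close> is finite and may be subtracted.\<close>
  have "fm \<le> cm"
    unfolding fm_def cm_def
  proof (rule nn_integral_mono)
    fix x
    have "- ?f x \<le> ereal (- c x)"
      using enn2ereal_nonneg[of "D x"] by (cases "enn2ereal (D x)") auto
    then show "e2ennreal (- ?f x) \<le> ennreal (- c x)"
      using e2ennreal_mono by fastforce
  qed
  have "enn2ereal fp - enn2ereal fm =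
    ereal (enn2real cp - enn2real cm) + enn2ereal (integral\<^sup>N M D)"
  proof -
    obtain p m f
      where pmf: "cp = ennreal p" "cm = ennreal m" "fm = ennreal f"
      "0 \<le> p" "0 \<le> m" "0 \<le> f"
      using fin \<open>fm \<le> cm\<close> by (cases cp; cases cm; cases fm) (auto simp: top_unique)
    show ?thesis
    proof (cases "integral\<^sup>N M D")
      case (real d)
      then have *: "fp + ennreal m = ennreal (f + (p + d))" using eq pmf by simp
      then obtain g where g: "fp = ennreal g" "0 \<le> g" by (cases fp) auto
      with * pmf real have "g + m = f + (p + d)" by (simp flip: ennreal_plus)
      with pmf real g show ?thesis by (simp add: enn2ereal_ennreal)
    next
      case top
      then have "fp = top" using eq pmf by (cases fp) (auto simp flip: ennreal_plus)
      then show ?thesis using top pmf by (simp add: enn2ereal_ennreal)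
    qed
  qed
  then show ?thesis
    by (simp add: ereal_integral_def fp_def fm_def int)
qed

lemma (in finite_measure) integrable_inner_Linf:
  fixes u w :: "'a \<Rightarrow> 'b::euclidean_space"
  assumes "u \<in> Linf M" "w \<in> Linf M"
  shows "integrable M (\<lambda>x. u x \<bullet> w x)"
proof -
  obtain C D where "0 \<le> C" "AE x in M. norm (u x) \<le> C" "AE x in M. norm (w x) \<le> D"
    using assms by (metis LinfE)
  then have "AE x in M. norm (u x \<bullet> w x) \<le> C * D"
    by (auto elim!: eventually_elim2 intro!: order_trans[OF Cauchy_Schwarz_ineq2] mult_mono)
  then show ?thesis using assms by (intro integrable_const_bound) auto
qed

lemma (in finite_measure) integrable_ln_partition_function:
  assumes "y \<in> Linf M"
  shows "integrable M (\<lambda>x. ln (partition_function V (y x)))"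
proof -
  obtain C where C: "AE x in M. norm (y x) \<le> C" using assms by (metis LinfE)
  have cont: "continuous_on A (\<lambda>y. ln (partition_function V y))" for A
    by (intro continuous_intros) (metis less_irrefl partition_function_pos)
  then have "bounded ((\<lambda>y. ln (partition_function V y)) ` cball 0 C)"
    by (intro compact_imp_bounded compact_continuous_image) auto
  then obtain B where "\<forall>y\<in>cball 0 C. norm (ln (partition_function V y)) \<le> B"
    unfolding bounded_iff by blast
  with C have "AE x in M. norm (ln (partition_function V (y x))) \<le> B"
    by (auto elim: eventually_mono)
  moreover have "(\<lambda>x. ln (partition_function V (y x))) \<in> borel_measurable M"
    using borel_measurable_continuous_onI[OF cont] assms by measurable
  ultimately show ?thesis by (intro integrable_const_bound)
qed

lemma polytopal_legendre_bounds:
  fixes V :: "real^'q^'n"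
  assumes "x \<in> (*v) V ` std_simplex"
  obtains t where "polytopal_legendre V x = ereal t" "- ln (real CARD('q)) \<le> t" "t \<le> 0"
proof -
  obtain l where l: "l \<in> std_simplex" "V *v l = x"
    "polytopal_legendre V x = ereal (neg_entropy l)"
    using assms by (rule polytopal_legendre_attained)
  have "l $ i \<le> 1" for i
    using l member_le_sum[of i UNIV "\<lambda>i. l $ i"] by (simp add: std_simplex_def)
  then have "neg_entropy l \<le> 0"
    unfolding neg_entropy_def
  proof (intro sum_nonpos)
    fix i
    have "0 \<le> l $ i" using l by (simp add: std_simplex_def)
    with \<open>l $ i \<le> 1\<close> show "l $ i * ln (l $ i) \<le> 0"
      by (cases "l $ i = 0") (auto simp: mult_nonneg_nonpos)
  qed
  \<comment> \<open>At slope 0 the Gibbs weights are uniform and the partition function counts the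
    columns of \<open>V\<close>.\<close>
  moreover have "- ln (real CARD('q)) \<le> neg_entropy l"
    using neg_entropy_gibbs(1)[OF l(1), of 0 V] by (simp add: partition_function_def)
  ultimately show thesis using that l by blast
qed

lemma (in finite_measure) integrable_polytopal_legendre:
  fixes V :: "real^'q^'n"
  assumes [measurable]: "v \<in> borel_measurable M" and v: "AE x in M. v x \<in> (*v) V ` std_simplex"
  shows "integrable M (\<lambda>x. real_of_ereal (polytopal_legendre V (v x)))"
proof -
  note borel_measurable_polytopal_legendre[measurable]
  have "AE x in M. norm (real_of_ereal (polytopal_legendre V (v x))) \<le> ln (real CARD('q))"
    using v by eventually_elim (auto elim!: polytopal_legendre_bounds)
  then show ?thesis by (intro integrable_const_bound) auto
qed

lemma ereal_integral_cong_AE: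
  assumes "AE x in M. f x = g x"
  shows "ereal_integral M f = ereal_integral M g"
proof -
  have "(\<integral>\<^sup>+x. e2ennreal (f x) \<partial>M) = (\<integral>\<^sup>+x. e2ennreal (g x) \<partial>M)"
    "(\<integral>\<^sup>+x. e2ennreal (- f x) \<partial>M) = (\<integral>\<^sup>+x. e2ennreal (- g x) \<partial>M)"
    using assms by (auto intro!: nn_integral_cong_AE)
  then show ?thesis by (simp add: ereal_integral_def)
qed

section \<open>The Fenchel gap and the rewriting of the objective\<close>

text \<open>The slack in the Fenchel-Young inequality. It is nonnegative, so the cast loses nothing;
  values in \<open>ennreal\<close> allow \<open>\<infinity>\<close> off the polytope and give access
  to the nonnegative integral.\<close>

definition fenchel_gap :: "real^'q^'n \<Rightarrow> real^'n \<Rightarrow> real^'n \<Rightarrow> ennreal" where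
  "fenchel_gap V y p =
     e2ennreal (polytopal_legendre V p - ereal (y \<bullet> p - ln (partition_function V y)))"

lemma enn2ereal_fenchel_gap:
  "enn2ereal (fenchel_gap V y p) =
     polytopal_legendre V p - ereal (y \<bullet> p - ln (partition_function V y))"
  unfolding fenchel_gap_def
  by (intro enn2ereal_e2ennreal)
     (use polytopal_legendre_ge_affine[of y p V] in \<open>simp add: ereal_diff_positive\<close>)

lemma fenchel_gap_eq_0_iff: "fenchel_gap V y p = 0 \<longleftrightarrow> p = gibbs_mean V y"
proof -
  have "fenchel_gap V y p = 0 \<longleftrightarrow> enn2ereal (fenchel_gap V y p) = 0"
    by (metis enn2ereal_inject zero_ennreal.rep_eq)
  also have "\<dots> \<longleftrightarrow> polytopal_legendre V p = ereal (y \<bullet> p - ln (partition_function V y))"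
    unfolding enn2ereal_fenchel_gap by (cases "polytopal_legendre V p") auto
  also have "\<dots> \<longleftrightarrow> p = gibbs_mean V y"
    by (rule polytopal_legendre_eq_affine_iff)
  finally show ?thesis .
qed

lemma measurable_fenchel_gap [measurable (raw)]:
  assumes [measurable]: "y \<in> borel_measurable M" "u \<in> borel_measurable M"
  shows "(\<lambda>x. fenchel_gap V (y x) (u x)) \<in> borel_measurable M"
proof -
  note borel_measurable_polytopal_legendre[measurable]
  have [measurable]: "partition_function V \<in> borel_measurable borel"
    by (intro borel_measurable_continuous_onI continuous_on_partition_function)
  show ?thesis unfolding fenchel_gap_def by measurable
qed

text \<open>With this \<open>y\<close> the terms linear in \<open>p\<close> combine to
  \<open>- (y \<bullet> p)\<close>, and what remains besides \<open>R\<close> at \<open>p\<close>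
  depends only on \<open>q\<close> and \<open>g\<close>. The value of \<open>R\<close> at
  \<open>q\<close> is finite, so it can be moved into the real summand; if \<open>R\<close> is
  infinite at \<open>p\<close>, both sides are \<open>\<infinity>\<close>.\<close>

lemma objective_integrand_eq:
  fixes V :: "real^'q^'n"
  assumes "q \<in> (*v) V ` std_simplex" and y: "y = grad_legendre V q - \<alpha> *\<^sub>R g"
  shows "ereal (\<alpha> * (g \<bullet> p)) + bregman V p q =
    ereal (grad_legendre V q \<bullet> q - ln (partition_function V y)
      - real_of_ereal (polytopal_legendre V q)) + enn2ereal (fenchel_gap V y p)"
proof -
  obtain t where "polytopal_legendre V q = ereal t"
    using assms(1) by (rule polytopal_legendre_bounds)
  then show ?thesis
    unfolding enn2ereal_fenchel_gap bregman_def
    by (cases "polytopal_legendre V p")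
       (auto simp: y inner_diff_left inner_diff_right)
qed

section \<open>Existence, uniqueness and interiority of the minimizer\<close>

theorem theorem4p4:
  fixes \<Omega> :: "(real^'d) set"
    and P :: "(real^'n) set"
    and V :: "real^'q^'n"
    and W :: "real^'n^'r"
    and b :: "real^'r"
    and \<alpha> :: real
    and v :: "real^'d \<Rightarrow> real^'n"
    and F :: "(real^'d \<Rightarrow> real^'n) \<Rightarrow> real"
    and F' :: "(real^'d \<Rightarrow> real^'n) \<Rightarrow> (real^'d \<Rightarrow> real^'n) \<Rightarrow> real"
    and gradF :: "(real^'d \<Rightarrow> real^'n) \<Rightarrow> (real^'d \<Rightarrow> real^'n)"
  assumes domain: "open \<Omega>" "connected \<Omega>" "\<Omega> \<noteq> {}"
    and finite_measure: "emeasure lebesgue \<Omega> < \<infinity>"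
    and polytope: "polytope P" "interior P \<noteq> {}"
    and vertices: "inj (\<lambda>i. column i V)" "range (\<lambda>i. column i V) = {p. p extreme_point_of P}"
    and alpha: "\<alpha> > 0"
    and v: "v \<in> constraint_K_interior \<Omega> P"
      "(\<lambda>x. grad_legendre V (v x)) \<in> Linf (lebesgue_on \<Omega>)"
    and F_well_defined: "\<And>u w. u \<in> Linf (lebesgue_on \<Omega>) \<Longrightarrow> w \<in> Linf (lebesgue_on \<Omega>) \<Longrightarrow>
      (AE x in lebesgue_on \<Omega>. u x = w x) \<Longrightarrow> F u = F w"
    and F_C1: "Linf_continuously_differentiable_on (lebesgue_on \<Omega>) F F' (constraint_A \<Omega> P W b)"
    and F_diff_v: "Linf_has_derivative (lebesgue_on \<Omega>) F (F' v) v"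
    and gradF: "\<And>u. u \<in> constraint_A \<Omega> P W b \<or> u = v \<Longrightarrow>
      Linf_represents (lebesgue_on \<Omega>) (gradF u) (F' u)"
  defines "J \<equiv> objective \<Omega> V \<alpha> (gradF v) v"
  shows "(\<forall>\<eta>\<in>Lone (lebesgue_on \<Omega>). J \<eta> \<noteq> -\<infinity>) \<and>
    (\<exists>\<eta>. is_arg_min J (\<lambda>\<zeta>. \<zeta> \<in> Lone (lebesgue_on \<Omega>)) \<eta> \<and>
      (\<forall>\<zeta>. is_arg_min J (\<lambda>\<zeta>. \<zeta> \<in> Lone (lebesgue_on \<Omega>)) \<zeta> \<longrightarrow>
        (AE x in lebesgue_on \<Omega>. \<zeta> x = \<eta> x)) \<and>
      \<eta> \<in> constraint_K \<Omega> P \<and>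
      \<eta> \<in> constraint_K_interior \<Omega> P \<and>
      (\<lambda>x. grad_legendre V (\<eta> x)) \<in> Linf (lebesgue_on \<Omega>))"
proof -
  define M where "M = lebesgue_on \<Omega>"
  have \<Omega>: "\<Omega> \<in> sets lebesgue" using domain(1) by (simp add: borel_open)
  interpret finite_measure M
    using finite_measure \<Omega>
    by (intro finite_measureI) (simp add: M_def emeasure_restrict_space)
  have P_eq: "P = (*v) V ` std_simplex"
    unfolding std_simplex_image_eq_hull vertices(2)
    by (intro Krein_Milman_Minkowski polytope_imp_compact polytope_imp_convex polytope(1))
  note int = polytope(2)[unfolded P_eq]
  have v_Linf: "v \<in> Linf M" and v_P: "AE x in M. v x \<in> (*v) V ` std_simplex"
    using v(1) unfolding constraint_K_interior_def constraint_K_def M_def P_eq by blast+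
  define w where "w = (\<lambda>x. grad_legendre V (v x))"
  define g where "g = gradF v"
  \<comment> \<open>The pointwise first-order condition for a minimizer \<open>\<eta>\<close> is
    \<open>\<alpha> *\<^sub>R g x + grad_legendre V (\<eta> x) - w x = 0\<close>; it prescribes
    \<open>y x\<close> as the gradient at \<open>\<eta> x\<close>.\<close>
  define y where "y = (\<lambda>x. w x - \<alpha> *\<^sub>R g x)"
  define \<eta> where "\<eta> = (\<lambda>x. gibbs_mean V (y x))"
  have w_Linf: "w \<in> Linf M" using v(2) by (simp add: w_def M_def)
  have "g \<in> Linf M" using gradF[of v] by (simp add: g_def M_def Linf_represents_def)
  then have y_Linf: "y \<in> Linf M"
    unfolding y_def by (intro Linf_diff Linf_scaleR w_Linf)
  note [measurable] = Linf_measurable[OF y_Linf]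
  \<comment> \<open>The part of the integrand that does not depend on the competitor. Its
    integrability lets it split off as a finite constant.\<close>
  define c where "c = (\<lambda>x. w x \<bullet> v x - ln (partition_function V (y x))
    - real_of_ereal (polytopal_legendre V (v x)))"
  have c: "integrable M c"
    unfolding c_def
    by (intro Bochner_Integration.integrable_diff integrable_inner_Linf w_Linf v_Linf y_Linf
        integrable_ln_partition_function integrable_polytopal_legendre v_P
        Linf_measurable[OF v_Linf])
  \<comment> \<open>This covers every measurable competitor, including those that leave the
    polytope, where the gap is infinite.\<close>
  have J_eq: "J \<zeta> = ereal (integral\<^sup>L M c) + enn2ereal (\<integral>\<^sup>+x. fenchel_gap V (y x) (\<zeta> x) \<partial>M)"
    if [measurable]: "\<zeta> \<in> borel_measurable M" for \<zeta>
  proof -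
    have "AE x in M. ereal (\<alpha> * (g x \<bullet> \<zeta> x)) + bregman V (\<zeta> x) (v x) =
        ereal (c x) + enn2ereal (fenchel_gap V (y x) (\<zeta> x))"
      using v_P by eventually_elim (simp add: objective_integrand_eq c_def y_def w_def)
    then have "J \<zeta> = ereal_integral M (\<lambda>x. ereal (c x) + enn2ereal (fenchel_gap V (y x) (\<zeta> x)))"
      unfolding J_def objective_def g_def M_def by (rule ereal_integral_cong_AE)
    then show ?thesis by (simp add: ereal_integral_add_nonneg[OF c])
  qed
  have [measurable]: "gibbs_mean V \<in> borel_measurable borel"
    by (intro borel_measurable_continuous_onI continuous_on_gibbs_mean)
  have \<eta>_meas [measurable]: "\<eta> \<in> borel_measurable M" unfolding \<eta>_def by measurable
  have \<eta>_P: "\<eta> x \<in> P" for x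
    using gibbs_mean_in_interior[OF int] interior_subset by (auto simp: \<eta>_def P_eq)
  obtain B where "\<And>p. p \<in> P \<Longrightarrow> norm p \<le> B"
    using polytope_imp_bounded[OF polytope(1)] by (auto simp: bounded_iff)
  then have \<eta>_bound: "norm (\<eta> x) \<le> B" for x using \<eta>_P by blast
  have \<eta>_Lone: "\<eta> \<in> Lone M"
    unfolding Lone_def mem_Collect_eq
    by (intro integrable_const_bound[of _ B]) (simp_all add: \<eta>_bound)
  have \<eta>_K: "\<eta> \<in> constraint_K \<Omega> P"
    using LinfI[OF \<eta>_meas, of B] \<eta>_bound \<eta>_P by (simp add: constraint_K_def flip: M_def)
  have Lone_meas: "\<zeta> \<in> borel_measurable M" if "\<zeta> \<in> Lone M" for \<zeta> :: "real^'d \<Rightarrow> real^'n"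
    using that by (simp add: Lone_def)
  have J_\<eta>: "J \<eta> = ereal (integral\<^sup>L M c)"
    unfolding J_eq[OF \<eta>_meas] by (simp add: \<eta>_def fenchel_gap_eq_0_iff[THEN iffD2] zero_ennreal.rep_eq)
  have J_ge: "J \<eta> \<le> J \<zeta>" if "\<zeta> \<in> Lone M" for \<zeta>
    unfolding J_\<eta> J_eq[OF Lone_meas[OF that]] using enn2ereal_nonneg[of "\<integral>\<^sup>+x. fenchel_gap V (y x) (\<zeta> x) \<partial>M"]
    by (cases "enn2ereal (\<integral>\<^sup>+x. fenchel_gap V (y x) (\<zeta> x) \<partial>M)") auto
  \<comment> \<open>A competitor that does no worse than \<open>\<eta>\<close> has a gap of integral
    0; being nonnegative, the gap vanishes almost everywhere, which identifies the competitor
    pointwise.\<close>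
  have unique: "AE x in M. \<zeta> x = \<eta> x" if "\<zeta> \<in> Lone M" "J \<zeta> \<le> J \<eta>" for \<zeta>
  proof -
    note [measurable] = Lone_meas[OF that(1)]
    have "enn2ereal (\<integral>\<^sup>+x. fenchel_gap V (y x) (\<zeta> x) \<partial>M) \<le> 0"
      using that(2) unfolding J_\<eta> J_eq[OF Lone_meas[OF that(1)]]
      by (cases "enn2ereal (\<integral>\<^sup>+x. fenchel_gap V (y x) (\<zeta> x) \<partial>M)") auto
    then have "(\<integral>\<^sup>+x. fenchel_gap V (y x) (\<zeta> x) \<partial>M) = 0"
      by (metis enn2ereal_inject enn2ereal_nonneg order_antisym zero_ennreal.rep_eq)
    then have "AE x in M. fenchel_gap V (y x) (\<zeta> x) = 0"
      by (subst (asm) nn_integral_0_iff_AE) simp_all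
    then show ?thesis by (simp add: fenchel_gap_eq_0_iff \<eta>_def)
  qed
  \<comment> \<open>The bound on \<open>y\<close> places almost all values of \<open>\<eta>\<close>
    in the image of one ball, where a single distance \<open>d\<close> serves.\<close>
  obtain C where C: "AE x in M. norm (y x) \<le> C" using y_Linf by (rule LinfE)
  obtain d where d: "0 < d" "\<And>z. norm z \<le> C \<Longrightarrow> d \<le> infdist (gibbs_mean V z) (frontier P)"
    using gibbs_mean_ball_away_from_frontier[OF int] unfolding P_eq by blast
  \<comment> \<open>The essential infimum is encoded through the essential supremum of the negated
    function, so the lower bound \<open>d\<close> is proved as the upper bound
    \<open>- d\<close>.\<close>
  have "esssup M (\<lambda>x. - ereal (infdist (\<eta> x) (frontier P))) \<le> - ereal d"
  proof (rule esssup_I)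
    show "AE x in M. - ereal (infdist (\<eta> x) (frontier P)) \<le> - ereal d"
      using C by eventually_elim (simp add: d(2) \<eta>_def)
    have [measurable]: "(\<lambda>p. infdist p (frontier P)) \<in> borel_measurable borel"
      by (intro borel_measurable_continuous_onI continuous_intros)
    show "(\<lambda>x. - ereal (infdist (\<eta> x) (frontier P))) \<in> borel_measurable M" by measurable
  qed
  then have "ereal d \<le> essinf M (\<lambda>x. ereal (infdist (\<eta> x) (frontier P)))"
    unfolding essinf_def by (metis ereal_minus_le_minus ereal_uminus_uminus)
  moreover have "0 < ereal d" using d(1) by simp
  ultimately have "0 < essinf M (\<lambda>x. ereal (infdist (\<eta> x) (frontier P)))"
    by (rule less_le_trans[rotated])
  with \<eta>_K have \<eta>_K_int: "\<eta> \<in> constraint_K_interior \<Omega> P"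
    by (simp add: constraint_K_interior_def M_def)
  have grad: "(\<lambda>x. grad_legendre V (\<eta> x)) \<in> Linf M"
    using y_Linf by (simp add: \<eta>_def grad_legendre_gibbs_mean[OF int])
  have "is_arg_min J (\<lambda>\<zeta>. \<zeta> \<in> Lone M) \<eta>"
    using \<eta>_Lone J_ge by (auto simp: is_arg_min_def not_less)
  moreover have "AE x in M. \<zeta> x = \<eta> x" if "is_arg_min J (\<lambda>\<zeta>. \<zeta> \<in> Lone M) \<zeta>" for \<zeta>
    using that \<eta>_Lone by (intro unique) (auto simp: is_arg_min_def not_less)
  moreover have "J \<zeta> \<noteq> -\<infinity>" if "\<zeta> \<in> Lone M" for \<zeta>
    using J_ge[OF that] by (auto simp: J_\<eta>)
  ultimately show ?thesis
    using \<eta>_K \<eta>_K_int grad unfolding M_def by blast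
qed

end
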